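(* Let $1\le d\le n$, let $F\subset\mathbb{R}^n$ be any fixed $d$-dimensional subspace of $\mathbb{R}^n$, and denote by $P_F$ the corresponding orthogonal projection matrix. Then, for any $t\ge 0$, $$\nu_{n,d}\big(\{P\in G_{n,d}: \big||P-P_F|^2-2d(1-d/n)\big|\ge t\}\big)\le 2\exp\big(-(n-1)t^2/(64d)\big).$$
   Context: $G_{n,d}=\{P\in\mathbb{R}^{n\times n}: P=P^T,\ P^2=P,\ \mathrm{rank}(P)=d\}$ is the Grassmann manifold (identifying $d$-dimensional subspaces with their orthogonal projection matrices). $\nu_{n,d}$ is the uniform distribution on $G_{n,d}$, i.e. the unique Borel probability measure invariant under $P\mapsto OPO^T$, $O\in O(n)$. $|X|=\lVert X\rVert_{\mathrm{HS}}=\sqrt{\mathrm{tr}(X^TX)}$ is the Hilbert–Schmidt norm. *)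

theory Defs
  imports "HOL-Probability.Probability"
begin

definition grassmannian :: "nat \<Rightarrow> (real^'n^'n) set" where
  "grassmannian d = {P. transpose P = P \<and> P ** P = P \<and> rank P = d}"

definition hs_norm :: "real^'n^'n \<Rightarrow> real" where
  "hs_norm X = sqrt (trace (transpose X ** X))"

lemma hs_norm_eq_norm: "hs_norm X = norm X"
proof -
  have "trace (transpose X ** X) = (\<Sum>j\<in>UNIV. \<Sum>i\<in>UNIV. X $ i $ j * X $ i $ j)"
    by (simp add: trace_def matrix_matrix_mult_def transpose_def)
  also have "\<dots> = X \<bullet> X"
    by (subst sum.swap) (simp add: inner_vec_def)
  finally show ?thesis
    by (simp add: hs_norm_def norm_eq_sqrt_inner)
qed

definition orth_proj :: "'a::euclidean_space set \<Rightarrow> 'a \<Rightarrow> 'a" where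
  "orth_proj F x = (THE y. y \<in> F \<and> x - y \<in> F\<^sup>\<bottom>)"

definition orth_proj_matrix :: "(real^'n) set \<Rightarrow> real^'n^'n" where
  "orth_proj_matrix F = matrix (orth_proj F)"

lemma orth_proj_ex1:
  fixes F :: "'a::euclidean_space set"
  assumes "subspace F"
  shows "\<exists>!y. y \<in> F \<and> x - y \<in> F\<^sup>\<bottom>"
proof -
  have span: "span F = F"
    using assms by simp
  obtain y z where yz: "y \<in> span F" "\<And>w. w \<in> span F \<Longrightarrow> orthogonal z w" "x = y + z"
    using orthogonal_subspace_decomp_exists[of F x] by blast
  show ?thesis
  proof (intro ex1I[of _ y] conjI)
    show "y \<in> F"
      using yz span by simp
    show "x - y \<in> F\<^sup>\<bottom>"
      using yz span by (auto simp: orthogonal_comp_def orthogonal_commute)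
    fix y' assume y': "y' \<in> F \<and> x - y' \<in> F\<^sup>\<bottom>"
    have "y - y' \<in> F"
      using yz y' span assms by (metis subspace_diff)
    moreover have "y - y' = (x - y') - (x - y)"
      by simp
    then have "y - y' \<in> F\<^sup>\<bottom>"
      using y' \<open>x - y \<in> F\<^sup>\<bottom>\<close> subspace_diff[OF subspace_orthogonal_comp] by metis
    ultimately have "orthogonal (y - y') (y - y')"
      unfolding orthogonal_comp_def by blast
    then show "y' = y"
      by (simp add: orthogonal_self)
  qed
qed

lemma orth_proj:
  assumes "subspace F"
  shows "orth_proj F x \<in> F" "x - orth_proj F x \<in> F\<^sup>\<bottom>"
  using theI'[OF orth_proj_ex1[OF assms]] by (simp_all add: orth_proj_def)

lemma orth_proj_eqI:
  assumes "subspace F" "y \<in> F" "x - y \<in> F\<^sup>\<bottom>"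
  shows "orth_proj F x = y"
  using orth_proj_ex1[OF assms(1), of x] orth_proj[OF assms(1), of x] assms(2,3) by blast

lemma linear_orth_proj:
  assumes "subspace F"
  shows "linear (orth_proj F)"
proof (rule linearI)
  note S = subspace_orthogonal_comp[of F]
  fix x y :: 'a and c :: real
  have "(x - orth_proj F x) + (y - orth_proj F y) \<in> F\<^sup>\<bottom>"
    using orth_proj[OF assms] S by (intro subspace_add) auto
  then show "orth_proj F (x + y) = orth_proj F x + orth_proj F y"
    using orth_proj[OF assms] assms
    by (intro orth_proj_eqI) (auto simp: subspace_add algebra_simps)
  have "c *\<^sub>R (x - orth_proj F x) \<in> F\<^sup>\<bottom>"
    using orth_proj[OF assms] S by (intro subspace_scale) auto
  then show "orth_proj F (c *\<^sub>R x) = c *\<^sub>R orth_proj F x"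
    using orth_proj[OF assms] assms
    by (intro orth_proj_eqI) (auto simp: subspace_scale algebra_simps)
qed

lemma orth_proj_matrix_mult:
  assumes "subspace F"
  shows "orth_proj_matrix F *v x = orth_proj F x"
  using linear_orth_proj[OF assms] by (simp add: orth_proj_matrix_def matrix_works)

lemma orth_proj_matrix_in_grassmannian:
  fixes F :: "(real^'n) set"
  assumes F: "subspace F"
  shows "orth_proj_matrix F \<in> grassmannian (dim F)"
proof -
  note lin = linear_orth_proj[OF F] and op = orth_proj[OF F]
  have idem: "orth_proj F y = y" if "y \<in> F" for y
    using that subspace_0[OF subspace_orthogonal_comp[of F]] by (intro orth_proj_eqI[OF F]) simp_all
  have sa: "orth_proj F x \<bullet> y = x \<bullet> orth_proj F y" for x y
  proof -
    have "orth_proj F x \<bullet> (y - orth_proj F y) = 0" "(x - orth_proj F x) \<bullet> orth_proj F y = 0"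
      using op[of x] op[of y] by (auto simp: orthogonal_comp_def orthogonal_def inner_commute)
    then show ?thesis
      by (simp add: inner_diff_left inner_diff_right)
  qed
  have "adjoint (orth_proj F) = orth_proj F"
    using sa by (intro adjoint_unique) auto
  then have "transpose (orth_proj_matrix F) = orth_proj_matrix F"
    using matrix_adjoint[OF lin] by (simp add: orth_proj_matrix_def)
  moreover have "orth_proj_matrix F ** orth_proj_matrix F = orth_proj_matrix F"
    unfolding matrix_eq matrix_vector_mul_assoc[symmetric] orth_proj_matrix_mult[OF F]
    using idem op by blast
  moreover have "range (orth_proj F) = F"
    using op(1) by (blast intro: idem[symmetric])
  then have "rank (orth_proj_matrix F) = dim F"
    by (simp add: rank_dim_range orth_proj_matrix_mult[OF F])
  ultimately show ?thesis
    by (simp add: grassmannian_def)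
qed

text \<open>
  There is exactly one such \<open>\<nu>\<close>, the uniform distribution; its existence and uniqueness
  are not proved here. The conjunct on \<open>sets \<nu>\<close> also forces \<open>space \<nu> = grassmannian d\<close>, and
  the image measure is not degenerate because conjugation is a measurable map
  of the Grassmannian to itself (\<open>measurable_conj\<close> below).
\<close>
definition uniform_on_grassmannian :: "nat \<Rightarrow> (real^'n^'n) measure \<Rightarrow> bool" where
  "uniform_on_grassmannian d \<nu> \<longleftrightarrow>
     prob_space \<nu> \<and>
     sets \<nu> = sets (restrict_space borel (grassmannian d)) \<and>
     (\<forall>Q. orthogonal_matrix Q \<longrightarrow> distr \<nu> \<nu> (\<lambda>P. Q ** P ** transpose Q) = \<nu>)"

lemma space_uniform_on_grassmannian:
  "uniform_on_grassmannian d \<nu> \<Longrightarrow> space \<nu> = grassmannian d"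
  by (auto simp: uniform_on_grassmannian_def space_restrict_space dest: sets_eq_imp_space_eq)

lemma conj_in_grassmannian:
  fixes P Q :: "real^'n^'n"
  assumes Q: "orthogonal_matrix Q" and P: "P \<in> grassmannian d"
  shows "Q ** P ** transpose Q \<in> grassmannian d"
proof -
  have QQ: "transpose Q ** Q = mat 1" "Q ** transpose Q = mat 1"
    using Q by (auto simp: orthogonal_matrix_def)
  have P': "transpose P = P" "P ** P = P" "rank P = d"
    using P by (auto simp: grassmannian_def)
  have "(Q ** P ** transpose Q) ** (Q ** P ** transpose Q)
        = Q ** (P ** ((transpose Q ** Q) ** P)) ** transpose Q"
    by (simp only: matrix_mul_assoc)
  then have "(Q ** P ** transpose Q) ** (Q ** P ** transpose Q) = Q ** P ** transpose Q"
    by (simp add: QQ P')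
  moreover have "transpose (Q ** P ** transpose Q) = Q ** P ** transpose Q"
    by (simp only: matrix_transpose_mul transpose_transpose P' matrix_mul_assoc)
  moreover have "rank (Q ** P ** transpose Q) = d"
  proof (rule antisym)
    show "rank (Q ** P ** transpose Q) \<le> d"
      using rank_mul_le_left[of "Q ** P" "transpose Q"] rank_mul_le_right[of Q P] P' by linarith
    have "P = transpose Q ** (Q ** P ** transpose Q) ** Q"
      by (simp only: matrix_mul_assoc[symmetric] QQ(1) matrix_mul_rid)
        (simp only: matrix_mul_assoc QQ(1) matrix_mul_lid)
    then show "d \<le> rank (Q ** P ** transpose Q)"
      using rank_mul_le_left[of "transpose Q ** (Q ** P ** transpose Q)" Q]
        rank_mul_le_right[of "transpose Q" "Q ** P ** transpose Q"] P' by simp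
  qed
  ultimately show ?thesis
    by (simp add: grassmannian_def)
qed

lemma measurable_conj:
  fixes Q :: "real^'n^'n"
  assumes Q: "orthogonal_matrix Q" and \<nu>: "sets \<nu> = sets (restrict_space borel (grassmannian d))"
  shows "(\<lambda>P. Q ** P ** transpose Q) \<in> \<nu> \<rightarrow>\<^sub>M \<nu>"
proof -
  have "continuous_on UNIV (\<lambda>P. Q ** P ** transpose Q)"
    unfolding matrix_matrix_mult_def by (intro continuous_intros)
  then have "(\<lambda>P. Q ** P ** transpose Q) \<in> borel_measurable borel"
    by (rule borel_measurable_continuous_onI)
  then have "(\<lambda>P. Q ** P ** transpose Q)
      \<in> restrict_space borel (grassmannian d) \<rightarrow>\<^sub>M restrict_space borel (grassmannian d)"
    using conj_in_grassmannian[OF Q]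
    by (intro measurable_restrict_space3) auto
  then show ?thesis
    using measurable_cong_sets[OF \<nu> \<nu>] by simp
qed

end

theory Submission
  imports Defs
begin

text \<open>
  All elements of the Grassmannian have Hilbert--Schmidt norm \<open>sqrt d\<close>, so
  \<open>|P - P\<^sub>F|\<^sup>2 - 2 d (1 - d / n) = - 2 g P\<close> with the centred overlap \<open>g P = P \<bullet> P\<^sub>F - d\<^sup>2 / n\<close>, and it
  suffices to show that \<open>g\<close> is sub-Gaussian.

  The proof uses invariance only through its infinitesimal form. If \<open>A\<close> is a skew matrix that
  generates the rotations of a coordinate plane, then the derivative of any smooth function in the
  direction \<open>[A, P]\<close> has expectation zero (\<open>expectation_infinitesimal_rotation_eq_0\<close>). Two facts make
  this sufficient. First, \<open>g\<close> is an eigenfunction of the Laplacian, the sum of the second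
  derivatives over all coordinate planes (\<open>sum_double_commutator_skew_unit\<close>). Second, its squared
  gradient is at most of order \<open>d\<close> (\<open>sum_inner_commutator_squared_le\<close> together with
  \<open>norm_mult_projections_le\<close>). Integrating by parts against the weight \<open>exp (\<theta> g)\<close> and summing over
  ordered pairs of coordinates turns these into
  \<open>4 n E (g exp (\<theta> g)) = \<theta> E (|\<nabla> g|\<^sup>2 exp (\<theta> g))\<close> with \<open>|\<nabla> g|\<^sup>2 \<le> 16 d\<close>. This is a differential
  inequality for the moment generating function, and integrating it gives \<open>E (exp (\<theta> g)) \<le> exp (2 d \<theta>\<^sup>2 / n)\<close>
  (\<open>expectation_exp_centred_overlap_le\<close>). Chernoff's argument gives the tail \<open>exp (- n s\<^sup>2 / (8 d))\<close> on
  each side, and \<open>s = t / 2\<close> yields the exponent \<open>n t\<^sup>2 / (32 d)\<close>, which is at least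
  \<open>(n - 1) t\<^sup>2 / (64 d)\<close>.
\<close>

section \<open>Commutators and rotations generated by skew matrices\<close>

definition commutator :: "real^'n^'n \<Rightarrow> real^'n^'n \<Rightarrow> real^'n^'n" where
  "commutator A X = A ** X - X ** A"

text \<open>
  The generator of the rotations in the coordinate plane of \<open>i\<close> and \<open>j\<close>. It is the zero matrix
  for \<open>i = j\<close> and changes sign when \<open>i\<close> and \<open>j\<close> are exchanged, so quadratic expressions in it can be
  summed over all ordered pairs; each plane is then counted twice.
\<close>
definition skew_unit :: "'n \<Rightarrow> 'n \<Rightarrow> real^'n^'n" where
  "skew_unit i j = (\<chi> a b. (if a = i \<and> b = j then 1 else 0) - (if a = j \<and> b = i then 1 else 0))"

text \<open>
  The matrix exponential of \<open>x *\<^sub>R A\<close> for a generator with \<open>A ** (A ** A) = - A\<close>, where the exponential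
  series collapses to a polynomial of degree two in \<open>A\<close>.
\<close>
definition rotation :: "real^'n^'n \<Rightarrow> real \<Rightarrow> real^'n^'n" where
  "rotation A x = mat 1 + sin x *\<^sub>R A + (1 - cos x) *\<^sub>R (A ** A)"

lemma bounded_bilinear_matrix_mult: "bounded_bilinear ((**) :: real^'n^'m \<Rightarrow> real^'k^'n \<Rightarrow> real^'k^'m)"
  unfolding bilinear_conv_bounded_bilinear[symmetric] bilinear_def
  by (auto intro!: linearI simp: matrix_matrix_mult_def vec_eq_iff algebra_simps sum.distrib sum_distrib_left)

lemmas matrix_mult_algebra =
  bounded_bilinear.add_left[OF bounded_bilinear_matrix_mult]
  bounded_bilinear.add_right[OF bounded_bilinear_matrix_mult]
  bounded_bilinear.diff_left[OF bounded_bilinear_matrix_mult]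
  bounded_bilinear.diff_right[OF bounded_bilinear_matrix_mult]
  bounded_bilinear.minus_left[OF bounded_bilinear_matrix_mult]
  bounded_bilinear.minus_right[OF bounded_bilinear_matrix_mult]
  bounded_bilinear.scaleR_left[OF bounded_bilinear_matrix_mult]
  bounded_bilinear.scaleR_right[OF bounded_bilinear_matrix_mult]

lemma bounded_linear_transpose: "bounded_linear (transpose :: real^'n^'m \<Rightarrow> real^'m^'n)"
  by (intro linear_conv_bounded_linear[THEN iffD1] linearI) (simp_all add: transpose_def vec_eq_iff)

lemma inner_eq_trace: "X \<bullet> Y = trace (transpose X ** Y)" for X Y :: "real^'n^'n"
proof -
  have "trace (transpose X ** Y) = (\<Sum>j\<in>UNIV. \<Sum>i\<in>UNIV. X $ i $ j * Y $ i $ j)"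
    by (simp add: trace_def matrix_matrix_mult_def transpose_def)
  also have "\<dots> = X \<bullet> Y"
    by (subst sum.swap) (simp add: inner_vec_def)
  finally show ?thesis ..
qed

lemma bounded_linear_commutator: "bounded_linear (commutator A)"
  unfolding commutator_def
  by (intro bounded_linear_sub bounded_bilinear.bounded_linear_right[OF bounded_bilinear_matrix_mult]
    bounded_bilinear.bounded_linear_left[OF bounded_bilinear_matrix_mult])

text \<open>
  Conjugation by orthogonal matrices is orthogonal for the Hilbert--Schmidt inner product, so its
  generator is skew-adjoint. This moves derivatives of \<open>P \<bullet> F\<close> from \<open>P\<close> to the fixed matrix \<open>F\<close>.
\<close>
lemma inner_commutator_skew:
  fixes A X Y :: "real^'n^'n"
  assumes "transpose A = - A"
  shows "commutator A X \<bullet> Y = - (X \<bullet> commutator A Y)"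
proof -
  have "trace (A ** transpose X ** Y) = trace (transpose X ** (Y ** A))"
    unfolding matrix_mul_assoc[symmetric] by (subst trace_mul_sym) (simp only: matrix_mul_assoc)
  then show ?thesis
    using assms by (simp add: inner_eq_trace commutator_def linear_diff[OF bounded_linear.linear[OF bounded_linear_transpose]]
      matrix_transpose_mul matrix_mult_algebra trace_sub matrix_mul_assoc)
qed

lemma has_vector_derivative_rotation:
  assumes "A ** (A ** A) = - A"
  shows "(rotation A has_vector_derivative A ** rotation A x) (at x)"
proof -
  have "((\<lambda>x. mat 1 + sin x *\<^sub>R A + (1 - cos x) *\<^sub>R (A ** A)) has_vector_derivative cos x *\<^sub>R A + sin x *\<^sub>R (A ** A)) (at x)"
    by (auto intro!: derivative_eq_intros simp: has_vector_derivative_def fun_eq_iff algebra_simps)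
  moreover have "A ** rotation A x = cos x *\<^sub>R A + sin x *\<^sub>R (A ** A)"
    by (simp add: rotation_def matrix_mult_algebra assms algebra_simps)
  ultimately show ?thesis by (simp add: rotation_def[abs_def])
qed

lemma has_vector_derivative_transpose_rotation:
  assumes "A ** (A ** A) = - A" "transpose A = - A"
  shows "((\<lambda>x. transpose (rotation A x)) has_vector_derivative - (transpose (rotation A x) ** A)) (at x)"
  using bounded_linear.has_vector_derivative[OF bounded_linear_transpose has_vector_derivative_rotation[OF assms(1)]]
  by (simp add: matrix_transpose_mul assms matrix_mult_algebra)

lemma orthogonal_matrix_rotation:
  assumes "A ** (A ** A) = - A" "transpose A = - A"
  shows "orthogonal_matrix (rotation A x)"
proof -
  \<comment> \<open>The curve \<open>R\<^sup>T R\<close> has derivative \<open>- R\<^sup>T A R + R\<^sup>T A R = 0\<close> and starts at the identity.\<close>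
  have "((\<lambda>x. transpose (rotation A x) ** rotation A x) has_vector_derivative 0) (at x within UNIV)" for x
    using bounded_bilinear.has_vector_derivative[OF bounded_bilinear_matrix_mult
       has_vector_derivative_transpose_rotation[OF assms] has_vector_derivative_rotation[OF assms(1)], of x]
    by (simp add: matrix_mult_algebra matrix_mul_assoc)
  then obtain c where "\<And>x. transpose (rotation A x) ** rotation A x = c"
    using has_vector_derivative_zero_constant[of UNIV "\<lambda>x. transpose (rotation A x) ** rotation A x"] by auto
  from this[of x] this[of 0] show ?thesis
    by (simp add: orthogonal_matrix rotation_def)
qed

lemma has_vector_derivative_conj_rotation:
  assumes "A ** (A ** A) = - A" "transpose A = - A"
  shows "((\<lambda>x. rotation A x ** P ** transpose (rotation A x)) has_vector_derivative
     commutator A (rotation A x ** P ** transpose (rotation A x))) (at x)"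
proof -
  note bb = bounded_bilinear.has_vector_derivative[OF bounded_bilinear_matrix_mult]
  show ?thesis
    using bb[OF bb[OF has_vector_derivative_rotation[OF assms(1), of x] has_vector_derivative_const[of P]]
       has_vector_derivative_transpose_rotation[OF assms]]
    by (simp add: matrix_mult_algebra matrix_mul_assoc commutator_def)
qed

section \<open>The elementary rotation generators\<close>

lemma transpose_skew_unit: "transpose (skew_unit i j) = - skew_unit i j"
  unfolding vec_eq_iff transpose_def skew_unit_def by (simp add: conj_commute)

lemma skew_unit_mult: "(skew_unit i j ** X) $ a $ b = (if a = i then X $ j $ b else 0) - (if a = j then X $ i $ b else 0)"
  by (cases "a = i"; cases "a = j")
    (simp_all add: skew_unit_def matrix_matrix_mult_def left_diff_distrib sum_subtractf mult_delta_left)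

lemma mult_skew_unit: "(X ** skew_unit i j) $ a $ b = (if b = j then X $ a $ i else 0) - (if b = i then X $ a $ j else 0)"
  by (cases "b = i"; cases "b = j")
    (simp_all add: skew_unit_def matrix_matrix_mult_def right_diff_distrib sum_subtractf mult_delta_right)

lemma skew_unit_cubed: "skew_unit i j ** (skew_unit i j ** skew_unit i j) = - skew_unit i j"
proof -
  have "(skew_unit i j ** (skew_unit i j ** skew_unit i j)) $ a $ b = - skew_unit i j $ a $ b" for a b
    by (cases "a = i"; cases "a = j"; cases "i = j"; cases "b = i"; cases "b = j")
      (simp_all add: skew_unit_mult, simp_all add: skew_unit_def)
  then show ?thesis
    by (simp add: vec_eq_iff)
qed

lemma commutator_skew_unit:
  "commutator (skew_unit i j) X $ a $ b =
   (if a = i then X $ j $ b else 0) - (if a = j then X $ i $ b else 0)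
   - (if b = j then X $ a $ i else 0) + (if b = i then X $ a $ j else 0)"
  by (simp add: commutator_def skew_unit_mult mult_skew_unit)

text \<open>
  Up to a constant factor this is the Casimir operator of the orthogonal group, acting on symmetric matrices by
  conjugation. Its eigenspaces are the multiples of the identity, with eigenvalue zero, and the
  traceless matrices, with eigenvalue \<open>- 4 n\<close>. This is why the centred
  function \<open>P \<bullet> F - d\<^sup>2 / n\<close> is an eigenfunction of the Laplacian. Entrywise the claim is a count
  of Kronecker deltas.
\<close>
lemma sum_double_commutator_skew_unit:
  fixes X :: "real^'n^'n"
  assumes "transpose X = X"
  shows "(\<Sum>i\<in>UNIV. \<Sum>j\<in>UNIV. commutator (skew_unit i j) (commutator (skew_unit i j) X))
     = (4 * trace X) *\<^sub>R mat 1 - (4 * real CARD('n)) *\<^sub>R X"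
proof -
  have s: "X $ b $ a = X $ a $ b" for a b
    using arg_cong[OF assms, of "\<lambda>M. M $ a $ b"] by (simp add: transpose_def)
  have sum_if: "(\<Sum>j\<in>UNIV. if p then f j else 0) = (if p then sum f UNIV else 0)" for p and f :: "'n \<Rightarrow> real"
    by simp
  have if_diff: "(if p then x - y else 0) = (if p then x else 0) - (if p then y else 0)"
    "(if p then x + y else 0) = (if p then x else 0) + (if p then y else 0)" for p and x y :: real
    by simp_all
  have "(\<Sum>i\<in>UNIV. \<Sum>j\<in>UNIV. commutator (skew_unit i j) (commutator (skew_unit i j) X) $ a $ b)
     = (4 * trace X) * (if a = b then 1 else 0) - (4 * real CARD('n)) * X $ a $ b" for a b
    by (simp add: commutator_skew_unit sum.distrib sum_subtractf s[of b a] trace_def if_diff sum_if)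
  then show ?thesis by (simp add: vec_eq_iff mat_def)
qed

text \<open>
  The left-hand side is the squared gradient of \<open>X \<mapsto> X \<bullet> Y\<close> along the rotations. Each derivative is
  twice an entry of the skew matrix \<open>(X Y)\<^sup>T - X Y\<close>, whose squared norm is at most \<open>4 |X Y|\<^sup>2\<close>.
\<close>
lemma sum_inner_commutator_squared_le:
  fixes X Y :: "real^'n^'n"
  assumes "transpose X = X" "transpose Y = Y"
  shows "(\<Sum>i\<in>UNIV. \<Sum>j\<in>UNIV. (commutator (skew_unit i j) X \<bullet> Y)\<^sup>2) \<le> 16 * (norm (X ** Y))\<^sup>2"
proof -
  let ?M = "X ** Y"
  have sX: "X $ b $ a = X $ a $ b" for a b
    using arg_cong[OF assms(1), of "\<lambda>M. M $ a $ b"] by (simp add: transpose_def)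
  have sY: "Y $ b $ a = Y $ a $ b" for a b
    using arg_cong[OF assms(2), of "\<lambda>M. M $ a $ b"] by (simp add: transpose_def)
  have *: "commutator (skew_unit i j) X \<bullet> Y = 2 * (?M $ j $ i - ?M $ i $ j)" for i j
  proof -
    have sum_if: "(\<Sum>k\<in>UNIV. if p then f k else 0) = (if p then sum f UNIV else 0)" for p and f :: "'n \<Rightarrow> real"
      by simp
    have "commutator (skew_unit i j) X \<bullet> Y =
     (\<Sum>b\<in>UNIV. X $ j $ b * Y $ i $ b) - (\<Sum>b\<in>UNIV. X $ i $ b * Y $ j $ b)
     - (\<Sum>a\<in>UNIV. X $ a $ i * Y $ a $ j) + (\<Sum>a\<in>UNIV. X $ a $ j * Y $ a $ i)"
      by (simp add: inner_vec_def commutator_skew_unit distrib_right left_diff_distrib mult_delta_left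
        sum.distrib sum_subtractf sum_if)
    moreover have "(\<Sum>b\<in>UNIV. X $ k $ b * Y $ l $ b) = ?M $ k $ l" for k l
      unfolding matrix_matrix_mult_def by (simp, rule sum.cong[OF refl], subst sY, rule refl)
    moreover have "(\<Sum>a\<in>UNIV. X $ a $ k * Y $ a $ l) = ?M $ k $ l" for k l
      unfolding matrix_matrix_mult_def by (simp, rule sum.cong[OF refl], subst sX, rule refl)
    ultimately show ?thesis
      by simp
  qed
  have n: "(norm ?M)\<^sup>2 = (\<Sum>i\<in>UNIV. \<Sum>j\<in>UNIV. (?M $ i $ j)\<^sup>2)"
    unfolding power2_norm_eq_inner inner_vec_def by (simp add: power2_eq_square)
  have "(\<Sum>i\<in>UNIV. \<Sum>j\<in>UNIV. (commutator (skew_unit i j) X \<bullet> Y)\<^sup>2) \<le>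
     (\<Sum>i\<in>UNIV. \<Sum>j\<in>UNIV. 8 * (?M $ j $ i)\<^sup>2 + 8 * (?M $ i $ j)\<^sup>2)"
  proof (intro sum_mono)
    fix i j
    have "0 \<le> 4 * (?M $ j $ i + ?M $ i $ j)\<^sup>2" by simp
    then show "(commutator (skew_unit i j) X \<bullet> Y)\<^sup>2 \<le> 8 * (?M $ j $ i)\<^sup>2 + 8 * (?M $ i $ j)\<^sup>2"
      unfolding * by (simp add: power2_eq_square algebra_simps)
  qed
  also have "\<dots> = 8 * (\<Sum>i\<in>UNIV. \<Sum>j\<in>UNIV. (?M $ j $ i)\<^sup>2) + 8 * (norm ?M)\<^sup>2"
    by (simp add: sum.distrib sum_distrib_left n)
  also have "(\<Sum>i\<in>UNIV. \<Sum>j\<in>UNIV. (?M $ j $ i)\<^sup>2) = (norm ?M)\<^sup>2"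
    unfolding n by (rule sum.swap)
  finally show ?thesis by simp
qed

section \<open>Traces and norms of projections\<close>

text \<open>
  A projection is the sum of \<open>b b\<^sup>T\<close> over an orthonormal basis of its range, and each summand has
  trace one.
\<close>
lemma trace_projection:
  assumes "P \<in> grassmannian d"
  shows "trace P = real d"
proof -
  have P: "transpose P = P" "P ** P = P" "rank P = d"
    using assms by (auto simp: grassmannian_def)
  let ?S = "range ((*v) P)"
  have "subspace ?S" by (simp add: subspace_UNIV linear_subspace_image)
  then obtain B where B: "B \<subseteq> ?S" "pairwise orthogonal B" "\<And>x. x \<in> B \<Longrightarrow> norm x = 1" "independent B" "card B = dim ?S" "span B = ?S"
    using orthonormal_basis_subspace by blast
  have fB: "finite B" using B(4) by (simp add: independent_imp_finite)
  have fix': "P *v b = b" if "b \<in> B" for b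
    using B(1) that P(2) by (auto simp: matrix_vector_mul_assoc)
  have sa: "(P *v x) \<bullet> y = x \<bullet> (P *v y)" for x y
    using P(1) by (metis dot_lmul_matrix vector_transpose_matrix)
  have ent: "P $ i $ i = (\<Sum>b\<in>B. (b $ i)\<^sup>2)" for i
  proof -
    have "P *v axis i 1 = (\<Sum>b\<in>B. ((P *v axis i 1) \<bullet> b) *\<^sub>R b)"
      using orthonormal_basis_expand[OF B(2) B(3) _ fB, of "P *v axis i 1"] unfolding B(6) by (metis rangeI)
    also have "\<dots> = (\<Sum>b\<in>B. (b $ i) *\<^sub>R b)"
      by (intro sum.cong refl) (simp add: sa fix' inner_axis')
    finally have "(P *v axis i 1) $ i = (\<Sum>b\<in>B. (b $ i)\<^sup>2)"
      by (simp add: power2_eq_square)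
    then show ?thesis by (simp add: matrix_vector_mult_basis column_def)
  qed
  have "trace P = (\<Sum>b\<in>B. \<Sum>i\<in>UNIV. (b $ i)\<^sup>2)"
    unfolding trace_def ent by (rule sum.swap)
  also have "\<dots> = (\<Sum>b\<in>B. (norm b)\<^sup>2)"
    unfolding power2_norm_eq_inner inner_vec_def by (simp add: power2_eq_square)
  also have "\<dots> = card B" using B(3) by simp
  finally show ?thesis using B(5) P(3) by (simp add: rank_dim_range)
qed

lemma norm_projection:
  assumes "P \<in> grassmannian d"
  shows "(norm P)\<^sup>2 = real d"
  using assms trace_projection[OF assms]
  by (simp add: power2_norm_eq_inner inner_eq_trace grassmannian_def)

text \<open>
  Since \<open>P\<close> and \<open>F\<close> are symmetric and idempotent, \<open>|P F|\<^sup>2 = tr (P F) = P \<bullet> F\<close>. Cauchy--Schwarz gives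
  \<open>d\<close>, whereas multiplying the norms would only give \<open>d\<^sup>2\<close>. The concentration rate depends on
  this power of \<open>d\<close>.
\<close>
lemma norm_mult_projections_le:
  assumes "P \<in> grassmannian d" "F \<in> grassmannian d"
  shows "(norm (P ** F))\<^sup>2 \<le> real d"
proof -
  have "(P ** F) \<bullet> (P ** F) = trace (F ** P ** P ** F)"
    using assms by (simp add: inner_eq_trace matrix_transpose_mul grassmannian_def matrix_mul_assoc)
  also have "F ** P ** P ** F = F ** (P ** P) ** F"
    by (simp only: matrix_mul_assoc)
  also have "\<dots> = F ** P ** F"
    using assms(1) by (simp add: grassmannian_def)
  also have "trace \<dots> = trace (P ** (F ** F))"
    unfolding matrix_mul_assoc[symmetric] by (subst trace_mul_sym) (simp only: matrix_mul_assoc)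
  also have "\<dots> = P \<bullet> F"
    using assms by (simp add: inner_eq_trace grassmannian_def)
  also have "\<dots> \<le> norm P * norm F" by (rule norm_cauchy_schwarz)
  also have "norm F = norm P"
    using norm_projection[OF assms(1)] norm_projection[OF assms(2)]
    by (intro power2_eq_imp_eq[of "norm F" "norm P"]) simp_all
  also have "norm P * norm P = real d"
    using norm_projection[OF assms(1)] by (simp add: power2_eq_square)
  finally show ?thesis by (simp add: power2_norm_eq_inner)
qed

section \<open>Differentiation under the expectation\<close>

text \<open>
  The mean value theorem bounds the difference quotients by the bound on the derivative, so
  dominated convergence applies.
\<close>
lemma (in prob_space) has_real_derivative_expectation:
  fixes \<phi> \<psi> :: "real \<Rightarrow> 'a \<Rightarrow> real"
  assumes int: "\<And>x. integrable M (\<phi> x)"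
    and [measurable]: "\<psi> a \<in> borel_measurable M"
    and der: "\<And>x \<omega>. \<omega> \<in> space M \<Longrightarrow> ((\<lambda>x. \<phi> x \<omega>) has_real_derivative \<psi> x \<omega>) (at x)"
    and bound: "\<And>x \<omega>. \<omega> \<in> space M \<Longrightarrow> \<bar>x - a\<bar> \<le> 1 \<Longrightarrow> \<bar>\<psi> x \<omega>\<bar> \<le> B"
  shows "((\<lambda>x. expectation (\<phi> x)) has_real_derivative expectation (\<psi> a)) (at a)"
proof -
  define q where "q h \<omega> = (\<phi> (a + h) \<omega> - \<phi> a \<omega>) / h" for h \<omega>
  have bq: "\<bar>q h \<omega>\<bar> \<le> B" if "\<omega> \<in> space M" "\<bar>h\<bar> \<le> 1" "h \<noteq> 0" for h \<omega>
  proof -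
    have "norm (\<phi> (a + h) \<omega> - \<phi> a \<omega>) \<le> B * norm (a + h - a)"
    proof (rule field_differentiable_bound[where S = "{a - 1..a + 1}" and f' = "\<lambda>x. \<psi> x \<omega>"])
      show "((\<lambda>x. \<phi> x \<omega>) has_field_derivative \<psi> x \<omega>) (at x within {a - 1..a + 1})" for x
        using der[OF that(1)] has_field_derivative_at_within by blast
      show "norm (\<psi> x \<omega>) \<le> B" if "x \<in> {a - 1..a + 1}" for x
        using bound[OF \<open>\<omega> \<in> space M\<close>, of x] that by (auto simp: abs_le_iff)
    qed (use that in \<open>auto simp: abs_le_iff\<close>)
    then show ?thesis
      using that(3) by (simp add: q_def abs_divide divide_le_eq)
  qed
  have [measurable]: "q h \<in> borel_measurable M" for h
    unfolding q_def using int[THEN borel_measurable_integrable] by measurable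
  have "((\<lambda>h. expectation (q h)) \<longlongrightarrow> expectation (\<psi> a)) (at 0)"
    unfolding tendsto_at_iff_sequentially
  proof (intro allI impI)
    fix X :: "nat \<Rightarrow> real"
    assume X: "\<forall>i. X i \<in> UNIV - {0}" "X \<longlonglongrightarrow> 0"
    \<comment> \<open>The derivative is controlled only at distance at most one from \<open>a\<close>; drop the terms outside.\<close>
    obtain N where N: "\<And>k. k \<ge> N \<Longrightarrow> \<bar>X k\<bar> \<le> 1"
      using X(2)[THEN LIMSEQ_D, of 1] by (auto intro: less_imp_le)
    have "(\<lambda>k. expectation (q (X (k + N)))) \<longlonglongrightarrow> expectation (\<psi> a)"
    proof (rule integral_dominated_convergence[where w = "\<lambda>_. B"])
      show "AE \<omega> in M. (\<lambda>k. q (X (k + N)) \<omega>) \<longlonglongrightarrow> \<psi> a \<omega>"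
      proof (intro AE_I2)
        fix \<omega> assume "\<omega> \<in> space M"
        from der[OF this, of a] have "((\<lambda>h. q h \<omega>) \<longlongrightarrow> \<psi> a \<omega>) (at 0)"
          by (simp add: DERIV_def q_def)
        then have "(\<lambda>k. q (X k) \<omega>) \<longlonglongrightarrow> \<psi> a \<omega>"
          using X unfolding tendsto_at_iff_sequentially by (auto simp: o_def)
        then show "(\<lambda>k. q (X (k + N)) \<omega>) \<longlonglongrightarrow> \<psi> a \<omega>"
          by (rule LIMSEQ_ignore_initial_segment)
      qed
      show "AE \<omega> in M. norm (q (X (k + N)) \<omega>) \<le> B" for k
        using bq N[of "k + N"] X(1) by (intro AE_I2) auto
    qed auto
    then show "((\<lambda>h. expectation (q h)) \<circ> X) \<longlonglongrightarrow> expectation (\<psi> a)"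
      unfolding o_def by (rule LIMSEQ_offset)
  qed
  moreover have "expectation (q h) = (expectation (\<phi> (a + h)) - expectation (\<phi> a)) / h" for h
    unfolding q_def using int by simp
  ultimately show ?thesis
    by (simp add: DERIV_def)
qed

section \<open>Expectations under the uniform distribution\<close>

lemma continuous_bounded_on_grassmannian:
  fixes k :: "real^'n^'n \<Rightarrow> real"
  assumes "continuous_on UNIV k"
  obtains B where "\<And>P. P \<in> grassmannian d \<Longrightarrow> \<bar>k P\<bar> \<le> B"
proof -
  have "grassmannian d \<subseteq> cball 0 (sqrt (real d))"
    using real_le_rsqrt[OF eq_refl[OF norm_projection]] by auto
  moreover have "bounded (k ` cball 0 (sqrt (real d)))"
    by (intro compact_imp_bounded compact_continuous_image continuous_on_subset[OF assms]) auto
  ultimately have "bounded (k ` grassmannian d)"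
    by (meson bounded_subset image_mono)
  then show ?thesis
    using that by (auto simp: bounded_iff)
qed

lemma borel_measurable_uniform_on_grassmannian:
  fixes k :: "real^'n^'n \<Rightarrow> real"
  assumes "uniform_on_grassmannian d \<nu>" "continuous_on UNIV k"
  shows "k \<in> borel_measurable \<nu>"
proof -
  have "k \<in> borel_measurable (restrict_space borel (grassmannian d))"
    by (intro measurable_restrict_space1 borel_measurable_continuous_onI assms)
  moreover have "sets \<nu> = sets (restrict_space borel (grassmannian d))"
    using assms(1) by (simp add: uniform_on_grassmannian_def)
  ultimately show ?thesis
    using measurable_cong_sets by blast
qed

lemma integrable_uniform_on_grassmannian:
  fixes k :: "real^'n^'n \<Rightarrow> real"
  assumes "uniform_on_grassmannian d \<nu>" "continuous_on UNIV k"
  shows "integrable \<nu> k"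
proof -
  interpret prob_space \<nu>
    using assms(1) by (simp add: uniform_on_grassmannian_def)
  obtain B where "\<And>P. P \<in> grassmannian d \<Longrightarrow> \<bar>k P\<bar> \<le> B"
    using continuous_bounded_on_grassmannian[OF assms(2)] by blast
  then show ?thesis
    using space_uniform_on_grassmannian[OF assms(1)] borel_measurable_uniform_on_grassmannian[OF assms]
    by (intro integrable_const_bound[of _ B] AE_I2) auto
qed

lemma expectation_conj_invariant:
  fixes k :: "real^'n^'n \<Rightarrow> real"
  assumes "uniform_on_grassmannian d \<nu>" "continuous_on UNIV k" "orthogonal_matrix Q"
  shows "(\<integral>P. k (Q ** P ** transpose Q) \<partial>\<nu>) = (\<integral>P. k P \<partial>\<nu>)"
proof -
  have "(\<integral>P. k P \<partial>\<nu>) = (\<integral>P. k P \<partial>distr \<nu> \<nu> (\<lambda>P. Q ** P ** transpose Q))"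
    using assms(1,3) by (simp add: uniform_on_grassmannian_def)
  also have "\<dots> = (\<integral>P. k (Q ** P ** transpose Q) \<partial>\<nu>)"
    using assms by (intro integral_distr measurable_conj borel_measurable_uniform_on_grassmannian)
      (auto simp: uniform_on_grassmannian_def)
  finally show ?thesis ..
qed

text \<open>
  Integration by parts on the Grassmannian. By invariance the expectation of \<open>h\<close> along the rotated
  variable is constant in the angle, so its derivative at angle zero vanishes; that derivative is the
  expectation of the derivative of \<open>h\<close> in the direction \<open>commutator A P\<close>.
\<close>
lemma expectation_infinitesimal_rotation_eq_0:
  fixes h :: "real^'n^'n \<Rightarrow> real"
  assumes u: "uniform_on_grassmannian d \<nu>"
    and A: "A ** (A ** A) = - A" "transpose A = - A"
    and h: "\<And>X. (h has_derivative h' X) (at X)"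
    and cont: "continuous_on UNIV (\<lambda>X. h' X (commutator A X))"
  shows "(\<integral>P. h' P (commutator A P) \<partial>\<nu>) = 0"
proof -
  interpret prob_space \<nu>
    using u by (simp add: uniform_on_grassmannian_def)
  define rot where "rot x P = rotation A x ** P ** transpose (rotation A x)" for x P
  let ?k = "\<lambda>X. h' X (commutator A X)"
  obtain B where B: "\<And>P. P \<in> grassmannian d \<Longrightarrow> \<bar>?k P\<bar> \<le> B"
    using continuous_bounded_on_grassmannian[OF cont] by blast
  have conth: "continuous_on UNIV h"
    using h by (intro continuous_at_imp_continuous_on ballI has_derivative_continuous) blast
  have rot0: "rot 0 P = P" for P
    by (simp add: rot_def rotation_def)
  have cont_rot: "continuous_on UNIV (rot x)" for x
    unfolding rot_def matrix_matrix_mult_def by (intro continuous_intros)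
  have "((\<lambda>x. expectation (\<lambda>P. h (rot x P))) has_real_derivative expectation (\<lambda>P. ?k (rot 0 P))) (at 0)"
  proof (rule has_real_derivative_expectation)
    show "integrable \<nu> (\<lambda>P. h (rot x P))" for x
      by (intro integrable_uniform_on_grassmannian[OF u] continuous_on_compose2[OF conth cont_rot]) simp
    show "(\<lambda>P. ?k (rot 0 P)) \<in> borel_measurable \<nu>"
      unfolding rot0 by (rule borel_measurable_uniform_on_grassmannian[OF u cont])
    show "((\<lambda>x. h (rot x P)) has_real_derivative ?k (rot x P)) (at x)" for x P
    proof -
      have "((\<lambda>x. h (rot x P)) has_derivative (\<lambda>y. h' (rot x P) (y *\<^sub>R commutator A (rot x P)))) (at x)"
        using has_vector_derivative_conj_rotation[OF A, where P = P and x = x]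
        by (intro has_derivative_compose[OF _ h]) (simp add: rot_def has_vector_derivative_def)
      then show ?thesis
        by (simp add: has_field_derivative_def linear_cmul[OF has_derivative_linear[OF h]] mult.commute[of _ "?k _"])
    qed
    show "\<bar>?k (rot x P)\<bar> \<le> B" if "P \<in> space \<nu>" for x P
      using that unfolding rot_def space_uniform_on_grassmannian[OF u]
      by (intro B conj_in_grassmannian orthogonal_matrix_rotation A)
  qed
  moreover have "expectation (\<lambda>P. h (rot x P)) = expectation h" for x
    unfolding rot_def by (rule expectation_conj_invariant[OF u conth orthogonal_matrix_rotation[OF A]])
  ultimately show ?thesis
    using DERIV_unique[OF _ DERIV_const] by (simp add: rot0)
qed

section \<open>Concentration of the overlap of two projections\<close>

text \<open>
  Integration by parts for the function \<open>(commutator A P \<bullet> F) exp (\<theta> g P)\<close>, summed over the generators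
  \<open>A = skew_unit i j\<close>. The second derivatives of \<open>g\<close> add up to \<open>- 4 n g\<close> because \<open>g\<close> is an
  eigenfunction, and differentiating the exponential weight produces the squared gradient \<open>G\<close>.
\<close>
lemma expectation_centred_overlap_identity:
  fixes F :: "real^'n^'n"
  assumes u: "uniform_on_grassmannian d \<nu>" and F: "F \<in> grassmannian d"
  defines "g \<equiv> \<lambda>P. P \<bullet> F - (real d)\<^sup>2 / real CARD('n)"
  defines "G \<equiv> \<lambda>P. \<Sum>i\<in>UNIV. \<Sum>j\<in>UNIV. (commutator (skew_unit i j) P \<bullet> F)\<^sup>2"
  shows "4 * real CARD('n) * (\<integral>P. g P * exp (\<theta> * g P) \<partial>\<nu>) = \<theta> * (\<integral>P. G P * exp (\<theta> * g P) \<partial>\<nu>)"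
proof -
  have F': "transpose F = F" "trace F = real d"
    using F trace_projection[OF F] by (auto simp: grassmannian_def)
  let ?w = "\<lambda>P. exp (\<theta> * g P)"
  let ?D = "\<lambda>i j X. commutator (skew_unit i j) X \<bullet> F"
  let ?K = "\<lambda>i j P. (P \<bullet> commutator (skew_unit i j) (commutator (skew_unit i j) F) + \<theta> * (?D i j P)\<^sup>2) * ?w P"
  note lin = bounded_linear_commutator[THEN bounded_linear.has_derivative]
  note cont_comm [continuous_intros] = bounded_linear.continuous_on[OF bounded_linear_commutator]
  have contK: "continuous_on UNIV (?K i j)" for i j
    unfolding g_def by (intro continuous_intros)
  have zero: "(\<integral>P. ?K i j P \<partial>\<nu>) = 0" for i j
  proof -
    let ?A = "skew_unit i j"
    let ?h = "\<lambda>X. ?D i j X * ?w X"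
    let ?h' = "\<lambda>X Z. ?D i j X * (?w X * (\<theta> * (Z \<bullet> F))) + ?D i j Z * ?w X"
    \<comment> \<open>Two applications of skew-adjointness turn the second derivative into \<open>P \<bullet> [A, [A, F]]\<close>.\<close>
    have eq: "?h' X (commutator ?A X) = ?K i j X" for X
      by (simp add: inner_commutator_skew[OF transpose_skew_unit, of i j "commutator ?A X"]
         inner_commutator_skew[OF transpose_skew_unit, of i j X "commutator ?A F"] power2_eq_square algebra_simps)
    have "(?h has_derivative ?h' X) (at X)" for X
      unfolding g_def by (auto intro!: derivative_eq_intros lin)
    from expectation_infinitesimal_rotation_eq_0[OF u skew_unit_cubed[of i j] transpose_skew_unit this] contK[of i j]
    show ?thesis unfolding eq by blast
  qed
  have "0 = (\<Sum>i\<in>UNIV. \<Sum>j\<in>UNIV. \<integral>P. ?K i j P \<partial>\<nu>)"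
    by (simp add: zero)
  also have "\<dots> = (\<integral>P. (\<Sum>i\<in>UNIV. \<Sum>j\<in>UNIV. ?K i j P) \<partial>\<nu>)"
    using integrable_uniform_on_grassmannian[OF u contK] by simp
  also have "\<dots> = (\<integral>P. \<theta> * (G P * ?w P) - 4 * real CARD('n) * (g P * ?w P) \<partial>\<nu>)"
  proof (rule Bochner_Integration.integral_cong[OF refl])
    fix P assume "P \<in> space \<nu>"
    then have "trace P = real d" "transpose P = P"
      unfolding space_uniform_on_grassmannian[OF u]
      using trace_projection[of P d] by (auto simp: grassmannian_def)
    then have "P \<bullet> mat 1 = real d"
      by (simp add: inner_eq_trace)
    then have "P \<bullet> (\<Sum>i\<in>UNIV. \<Sum>j\<in>UNIV. commutator (skew_unit i j) (commutator (skew_unit i j) F)) = - 4 * real CARD('n) * g P"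
      unfolding sum_double_commutator_skew_unit[OF F'(1)] by (simp add: F' inner_diff_right g_def power2_eq_square field_simps)
    then show "(\<Sum>i\<in>UNIV. \<Sum>j\<in>UNIV. ?K i j P) = \<theta> * (G P * ?w P) - 4 * real CARD('n) * (g P * ?w P)"
      unfolding G_def sum_distrib_right[symmetric] sum.distrib sum_distrib_left[symmetric] inner_sum_right[symmetric]
      by (simp add: algebra_simps)
  qed
  also have "\<dots> = \<theta> * (\<integral>P. G P * ?w P \<partial>\<nu>) - 4 * real CARD('n) * (\<integral>P. g P * ?w P \<partial>\<nu>)"
  proof -
    have "integrable \<nu> (\<lambda>P. G P * ?w P)" "integrable \<nu> (\<lambda>P. g P * ?w P)"
      unfolding G_def g_def by (intro integrable_uniform_on_grassmannian[OF u] continuous_intros)+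
    then show ?thesis by simp
  qed
  finally show ?thesis by simp
qed

text \<open>
  With \<open>m x\<close> the moment generating function at \<open>x \<theta>\<close>, the previous identity and the gradient bound
  \<open>G \<le> 16 d\<close> give the differential inequality \<open>m' x \<le> 4 d \<theta>\<^sup>2 x m x / n\<close>, which integrates to a Gaussian
  bound at \<open>x = 1\<close>. Moving along the segment from \<open>0\<close> to \<open>\<theta>\<close> treats both signs of \<open>\<theta>\<close> at once.
\<close>
lemma expectation_exp_centred_overlap_le:
  fixes F :: "real^'n^'n"
  assumes u: "uniform_on_grassmannian d \<nu>" and F: "F \<in> grassmannian d"
  defines "g \<equiv> \<lambda>P. P \<bullet> F - (real d)\<^sup>2 / real CARD('n)"
  shows "(\<integral>P. exp (\<theta> * g P) \<partial>\<nu>) \<le> exp (2 * real d * \<theta>\<^sup>2 / real CARD('n))"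
proof -
  interpret prob_space \<nu>
    using u by (simp add: uniform_on_grassmannian_def)
  let ?n = "real CARD('n)"
  define m where "m x = expectation (\<lambda>P. exp (x * \<theta> * g P))" for x
  define m' where "m' x = expectation (\<lambda>P. \<theta> * g P * exp (x * \<theta> * g P))" for x
  define c where "c = 2 * real d * \<theta>\<^sup>2 / ?n"
  define G where "G P = (\<Sum>i\<in>UNIV. \<Sum>j\<in>UNIV. (commutator (skew_unit i j) P \<bullet> F)\<^sup>2)" for P
  note cont_comm [continuous_intros] = bounded_linear.continuous_on[OF bounded_linear_commutator]
  have cont_g [continuous_intros]: "continuous_on S g" for S
    unfolding g_def by (intro continuous_intros)
  have int: "integrable \<nu> k" if "continuous_on UNIV k" for k :: "_ \<Rightarrow> real"
    by (rule integrable_uniform_on_grassmannian[OF u that])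
  have G_le: "G P \<le> 16 * real d" if "P \<in> space \<nu>" for P
  proof -
    have P: "P \<in> grassmannian d"
      using that space_uniform_on_grassmannian[OF u] by simp
    have "G P \<le> 16 * (norm (P ** F))\<^sup>2"
      unfolding G_def using P F by (intro sum_inner_commutator_squared_le) (auto simp: grassmannian_def)
    with norm_mult_projections_le[OF P F] show ?thesis by simp
  qed
  have der: "(m has_real_derivative m' a) (at a)" for a
  proof -
    obtain C where C: "\<And>P. P \<in> grassmannian d \<Longrightarrow> \<bar>\<theta> * g P\<bar> \<le> C"
      by (rule continuous_bounded_on_grassmannian[of "\<lambda>P. \<theta> * g P" d]) (intro continuous_intros, blast)
    show ?thesis
      unfolding m_def m'_def
    proof (rule has_real_derivative_expectation[where B = "C * exp ((\<bar>a\<bar> + 1) * C)"])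
      show "integrable \<nu> (\<lambda>P. exp (x * \<theta> * g P))" for x
        by (intro int continuous_intros)
      show "(\<lambda>P. \<theta> * g P * exp (a * \<theta> * g P)) \<in> borel_measurable \<nu>"
        by (intro borel_measurable_integrable int continuous_intros)
      show "((\<lambda>x. exp (x * \<theta> * g P)) has_real_derivative \<theta> * g P * exp (x * \<theta> * g P)) (at x)" for x P
        by (auto intro!: derivative_eq_intros)
      fix x P assume "P \<in> space \<nu>" and x: "\<bar>x - a\<bar> \<le> 1"
      then have *: "\<bar>\<theta> * g P\<bar> \<le> C"
        using C space_uniform_on_grassmannian[OF u] by simp
      have "x * (\<theta> * g P) \<le> \<bar>x\<bar> * \<bar>\<theta> * g P\<bar>"
        by (metis abs_ge_self abs_mult)
      also have "\<dots> \<le> (\<bar>a\<bar> + 1) * C"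
        using x * by (intro mult_mono) auto
      finally have "exp (x * \<theta> * g P) \<le> exp ((\<bar>a\<bar> + 1) * C)"
        by (simp add: mult.assoc)
      then show "\<bar>\<theta> * g P * exp (x * \<theta> * g P)\<bar> \<le> C * exp ((\<bar>a\<bar> + 1) * C)"
        using * unfolding abs_mult[of "\<theta> * g P"] by (intro mult_mono) auto
    qed
  qed
  have m'_le: "m' x \<le> 2 * x * c * m x" if "x \<ge> 0" for x
  proof -
    have "4 * ?n * m' x = \<theta> * (4 * ?n * expectation (\<lambda>P. g P * exp (x * \<theta> * g P)))"
      unfolding m'_def by (simp add: mult.assoc)
    also have "\<dots> = x * \<theta>\<^sup>2 * expectation (\<lambda>P. G P * exp (x * \<theta> * g P))"
      using expectation_centred_overlap_identity[OF u F, of "x * \<theta>"] by (simp add: g_def G_def power2_eq_square)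
    also have "\<dots> \<le> x * \<theta>\<^sup>2 * expectation (\<lambda>P. 16 * real d * exp (x * \<theta> * g P))"
    proof (intro mult_left_mono integral_mono int)
      show "continuous_on UNIV (\<lambda>P. G P * exp (x * \<theta> * g P))"
        unfolding G_def by (intro continuous_intros)
    qed (use that G_le in \<open>auto intro!: continuous_intros\<close>)
    also have "\<dots> = 4 * ?n * (2 * x * c * m x)"
      by (simp add: m_def c_def)
    finally show ?thesis by (simp add: mult.assoc mult.left_commute)
  qed
  have "m 1 * exp (- (c * 1\<^sup>2)) \<le> m 0 * exp (- (c * 0\<^sup>2))"
  proof (rule DERIV_nonpos_imp_nonincreasing[where f = "\<lambda>x. m x * exp (- (c * x\<^sup>2))"])
    fix x :: real assume x: "0 \<le> x"
    have "((\<lambda>x. m x * exp (- (c * x\<^sup>2))) has_real_derivative (m' x - 2 * x * c * m x) * exp (- (c * x\<^sup>2))) (at x)"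
      by (auto intro!: derivative_eq_intros der simp: algebra_simps)
    moreover have "(m' x - 2 * x * c * m x) * exp (- (c * x\<^sup>2)) \<le> 0"
      using m'_le[OF x] by (intro mult_nonpos_nonneg) auto
    ultimately show "\<exists>y. ((\<lambda>x. m x * exp (- (c * x\<^sup>2))) has_real_derivative y) (at x) \<and> y \<le> 0"
      by blast
  qed simp
  then have "m 1 * exp (- c) \<le> 1"
    by (simp add: m_def prob_space)
  then show ?thesis
    by (simp add: m_def c_def exp_minus field_simps)
qed

text \<open>
  Chernoff's argument. The sign \<open>\<sigma>\<close> selects the upper or the lower tail.
\<close>
lemma centred_overlap_tail_bound:
  fixes F :: "real^'n^'n"
  assumes u: "uniform_on_grassmannian d \<nu>" and F: "F \<in> grassmannian d"
    and d: "1 \<le> d" and s: "s \<ge> 0" and \<sigma>: "\<sigma>\<^sup>2 = 1"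
  defines "g \<equiv> \<lambda>P. P \<bullet> F - (real d)\<^sup>2 / real CARD('n)"
  shows "measure \<nu> {P \<in> space \<nu>. \<sigma> * g P \<ge> s} \<le> exp (- (real CARD('n) * s\<^sup>2 / (8 * real d)))"
proof (cases "s = 0")
  case True
  interpret prob_space \<nu>
    using u by (simp add: uniform_on_grassmannian_def)
  show ?thesis using True by simp
next
  case False
  interpret prob_space \<nu>
    using u by (simp add: uniform_on_grassmannian_def)
  define n where "n = real CARD('n)"
  have n: "n > 0" by (simp add: n_def)
  \<comment> \<open>The minimiser of the exponent \<open>2 d \<theta>\<^sup>2 / n - \<theta> s\<close>.\<close>
  define \<theta> where "\<theta> = n * s / (4 * real d)"
  have \<theta>: "\<theta> > 0" using False s d n by (simp add: \<theta>_def)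
  have cont: "continuous_on UNIV (\<lambda>P. exp (\<theta> * \<sigma> * g P))"
    unfolding g_def by (intro continuous_intros)
  have "measure \<nu> {P \<in> space \<nu>. \<sigma> * g P \<ge> s} = measure \<nu> {P \<in> space \<nu>. exp (\<theta> * \<sigma> * g P) \<ge> exp (\<theta> * s)}"
    using \<theta> by (simp add: mult.assoc)
  also have "\<dots> \<le> expectation (\<lambda>P. exp (\<theta> * \<sigma> * g P)) / exp (\<theta> * s)"
    using integrable_uniform_on_grassmannian[OF u cont]
    by (intro integral_Markov_inequality_measure[where A = "{}"]) auto
  also have "\<dots> \<le> exp (2 * real d * (\<theta> * \<sigma>)\<^sup>2 / n) / exp (\<theta> * s)"
    using expectation_exp_centred_overlap_le[OF u F, of "\<theta> * \<sigma>"] by (intro divide_right_mono) (simp_all add: g_def n_def)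
  also have "\<dots> = exp (2 * real d * (\<theta> * \<sigma>)\<^sup>2 / n - \<theta> * s)"
    by (simp add: exp_diff)
  also have "2 * real d * (\<theta> * \<sigma>)\<^sup>2 / n - \<theta> * s = - (n * s\<^sup>2 / (8 * real d))"
    unfolding power_mult_distrib \<sigma> using d n by (simp add: \<theta>_def power2_eq_square field_simps)
  finally show ?thesis by (simp add: n_def)
qed

theorem proposition7p2:
  fixes F :: "(real^'n) set" and d :: nat and \<nu> :: "(real^'n^'n) measure" and t :: real
  assumes "1 \<le> d" and "d \<le> CARD('n)"
    and "subspace F" and "dim F = d"
    and "uniform_on_grassmannian d \<nu>"
    and "t \<ge> 0"
  shows "measure \<nu> {P \<in> grassmannian d.
           \<bar>(hs_norm (P - orth_proj_matrix F))\<^sup>2 - 2 * real d * (1 - real d / real CARD('n))\<bar> \<ge> t}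
         \<le> 2 * exp (- ((real CARD('n) - 1) * t\<^sup>2 / (64 * real d)))"
proof -
  note u = assms(5)
  interpret prob_space \<nu>
    using u by (simp add: uniform_on_grassmannian_def)
  define n where "n = real CARD('n)"
  define PF where "PF = orth_proj_matrix F"
  have PF: "PF \<in> grassmannian d"
    using orth_proj_matrix_in_grassmannian[OF assms(3)] assms(4) by (simp add: PF_def)
  define g where "g P = P \<bullet> PF - (real d)\<^sup>2 / n" for P
  have [measurable]: "g \<in> borel_measurable \<nu>"
    unfolding g_def by (intro borel_measurable_uniform_on_grassmannian[OF u] continuous_intros)
  \<comment> \<open>Both projections have squared norm \<open>d\<close>, so the distance only depends on the overlap \<open>P \<bullet> PF\<close>.\<close>
  have dist: "(hs_norm (P - PF))\<^sup>2 - 2 * real d * (1 - real d / n) = - 2 * g P" if "P \<in> grassmannian d" for P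
  proof -
    have "(norm (P - PF))\<^sup>2 = (norm P)\<^sup>2 + (norm PF)\<^sup>2 - 2 * (P \<bullet> PF)"
      by (simp add: power2_norm_eq_inner inner_diff_left inner_diff_right inner_commute[of PF P])
    then show ?thesis
      unfolding hs_norm_eq_norm norm_projection[OF that] norm_projection[OF PF]
      by (simp add: g_def power2_eq_square algebra_simps)
  qed
  have "t \<le> \<bar>(hs_norm (P - PF))\<^sup>2 - 2 * real d * (1 - real d / n)\<bar> \<longleftrightarrow> t / 2 \<le> 1 * g P \<or> t / 2 \<le> - 1 * g P"
    if "P \<in> grassmannian d" for P
    unfolding dist[OF that] by (auto simp: abs_if)
  then have "{P \<in> grassmannian d. \<bar>(hs_norm (P - PF))\<^sup>2 - 2 * real d * (1 - real d / n)\<bar> \<ge> t}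
    = {P \<in> space \<nu>. 1 * g P \<ge> t / 2} \<union> {P \<in> space \<nu>. - 1 * g P \<ge> t / 2}"
    unfolding space_uniform_on_grassmannian[OF u] by blast
  also have "measure \<nu> \<dots> \<le> measure \<nu> {P \<in> space \<nu>. 1 * g P \<ge> t / 2} + measure \<nu> {P \<in> space \<nu>. - 1 * g P \<ge> t / 2}"
    by (intro measure_Un_le) measurable
  also have "\<dots> \<le> 2 * exp (- (n * (t / 2)\<^sup>2 / (8 * real d)))"
    using centred_overlap_tail_bound[OF u PF assms(1), of "t / 2" 1] centred_overlap_tail_bound[OF u PF assms(1), of "t / 2" "- 1"] assms(6)
    unfolding n_def g_def by simp
  also have "\<dots> \<le> 2 * exp (- ((n - 1) * t\<^sup>2 / (64 * real d)))"
  proof -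
    have "(n - 1) * t\<^sup>2 / (64 * real d) \<le> (2 * n) * t\<^sup>2 / (64 * real d)"
      by (intro divide_right_mono mult_right_mono) (auto simp: n_def)
    then show ?thesis by (simp add: power_divide)
  qed
  finally show ?thesis by (simp add: PF_def n_def)
qed
end
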